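(* Let $x_1,\ldots,x_k\in S^2$ be distinct points, let $\tilde\mu>0$, and let $\tilde\alpha_1,\ldots,\tilde\alpha_k$ be real numbers. Suppose that $\beta:=-1-\sum_{j=1}^k\tilde\alpha_j$ is strictly positive. Then there is no map $\psi:S^2\to\mathbb{R}$ satisfying $$2\sum_{j=1}^k\tilde\alpha_j\delta_{x_j}(x)+\frac1{2\pi}-\frac1{2\pi}\Delta_{S^2}\psi(x)-2\tilde\mu e^{2\psi(x)}=0$$ on $S^2$.
   Context: $S^2\subset\mathbb{R}^3$ is the unit sphere with area measure $a$, $\Delta_{S^2}$ is the spherical Laplacian, and $\delta_x$ is the Dirac delta at $x$ (with respect to $a$). The equation is understood in the sense of distributions, for measurable $\psi$ such that $\psi$ and $e^{2\psi}$ are integrable with respect to $a$: tested against every smooth $\phi:S^2\to\mathbb{R}$, $$2\sum_{j}\tilde\alpha_j\phi(x_j)+\frac1{2\pi}\int\phi\,da-\frac1{2\pi}\int\psi\,\Delta_{S^2}\phi\,da-2\tilde\mu\int\phi\,e^{2\psi}\,da=0.$$ (A field satisfying this equation is what the paper calls a critical point of the functional $J(\psi)=-\chi\sum_j\tilde\alpha_j^2+\sum_j\tilde\alpha_j(1+\tilde\alpha_j)\ln g(\sigma(x_j))+\sum_j(2\tilde\alpha_j\psi(x_j)+2\tilde\alpha_j^2G(x_j,x_j))+\frac1{2\pi}\int\psi\,da-\frac1{4\pi}\int(\psi\Delta_{S^2}\psi+4\pi\tilde\mu e^{2\psi})\,da$.) *)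

theory Defs
  imports "HOL-Analysis.Analysis"
begin

abbreviation S2 :: "(real^3) set" where
  "S2 \<equiv> sphere 0 1"

subsection \<open>Area measure\<close>

definition spherical_coords :: "real \<times> real \<Rightarrow> real^3" where
  "spherical_coords = (\<lambda>(\<theta>, \<phi>). vector [sin \<theta> * cos \<phi>, sin \<theta> * sin \<phi>, cos \<theta>])"

text \<open>
  The density \<open>sin \<theta>\<close> is the area element of this parametrization, i.e. the norm of the cross
  product of its two partial derivatives. Taking the completion makes the measurable sets all
  Lebesgue measurable subsets of the sphere.
\<close>

definition sphere_area :: "(real^3) measure" where
  "sphere_area = completion (distr
     (density (restrict_space lborel ({0..pi} \<times> {0..2 * pi})) (\<lambda>(\<theta>, \<phi>). ennreal (sin \<theta>)))
     (restrict_space borel S2)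
     spherical_coords)"

subsection \<open>Smooth functions\<close>

text \<open>\<open>n\<close> times continuously differentiable on an open set \<open>U\<close>, in terms of iterated directional
  derivatives.\<close>

primrec Ck_on :: "nat \<Rightarrow> 'a::euclidean_space set \<Rightarrow> ('a \<Rightarrow> real) \<Rightarrow> bool" where
  "Ck_on 0 U f \<longleftrightarrow> continuous_on U f"
| "Ck_on (Suc n) U f \<longleftrightarrow>
     f differentiable_on U \<and> (\<forall>v. Ck_on n U (\<lambda>x. frechet_derivative f (at x) v))"

text \<open>Smoothness on an arbitrary subset of Euclidean space (in particular on an embedded
  submanifold): locally the restriction of a \<open>C\<^sup>\<infinity>\<close> function on an open set of the ambient space.\<close>

definition smooth_on :: "'a::euclidean_space set \<Rightarrow> ('a \<Rightarrow> real) \<Rightarrow> bool" where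
  "smooth_on S f \<longleftrightarrow>
     (\<forall>x\<in>S. \<exists>U g. open U \<and> x \<in> U \<and> (\<forall>n. Ck_on n U g) \<and> (\<forall>y\<in>S \<inter> U. g y = f y))"

subsection \<open>Spherical Laplacian\<close>

definition laplacian :: "('a::euclidean_space \<Rightarrow> real) \<Rightarrow> 'a \<Rightarrow> real" where
  "laplacian f x =
     (\<Sum>b\<in>Basis. frechet_derivative (\<lambda>y. frechet_derivative f (at y) b) (at x) b)"

text \<open>
  The Laplace--Beltrami operator of the round sphere (with the sign of div grad): the Euclidean
  Laplacian of the extension that is constant along rays. Only the values of \<open>f\<close> on the unit
  sphere enter.
\<close>

definition sphere_laplacian :: "(real^3 \<Rightarrow> real) \<Rightarrow> real^3 \<Rightarrow> real" where
  "sphere_laplacian f x = laplacian (\<lambda>y. f (y /\<^sub>R norm y)) x"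

subsection \<open>Distributional solutions\<close>

text \<open>
  A map from the sphere to the reals is represented by a function on \<open>real^3\<close> whose values off
  the sphere are irrelevant.
\<close>

definition critical_point ::
  "nat \<Rightarrow> (nat \<Rightarrow> real^3) \<Rightarrow> (nat \<Rightarrow> real) \<Rightarrow> real \<Rightarrow> (real^3 \<Rightarrow> real) \<Rightarrow> bool" where
  "critical_point k x \<alpha> \<mu> \<psi> \<longleftrightarrow>
     integrable sphere_area \<psi> \<and>
     integrable sphere_area (\<lambda>y. exp (2 * \<psi> y)) \<and>
     (\<forall>\<phi>. smooth_on S2 \<phi> \<longrightarrow>
        2 * (\<Sum>j=1..k. \<alpha> j * \<phi> (x j))
        + 1 / (2 * pi) * (LINT y|sphere_area. \<phi> y)
        - 1 / (2 * pi) * (LINT y|sphere_area. \<psi> y * sphere_laplacian \<phi> y)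
        - 2 * \<mu> * (LINT y|sphere_area. \<phi> y * exp (2 * \<psi> y)) = 0)"

end

theory Submission
  imports Defs
begin

text \<open>
  Testing the equation against \<open>\<phi> = 1\<close> gives an identity of Gauss--Bonnet type. The Laplacian term
  vanishes and the sphere has area \<open>4 * pi\<close>, so what remains says that \<open>2 * (\<Sum>j. \<alpha> j) + 2\<close> is
  \<open>2 * \<mu>\<close> times the integral of \<open>exp (2 * \<psi>)\<close>. The former equals \<open>- 2 * \<beta>\<close>, which is negative,
  whereas the latter is nonnegative.

  The one computation is the total area (\<open>integral_sphere_area_const\<close>). It is obtained in spherical
  coordinates from the integral of \<open>sin \<theta>\<close> over the rectangle \<open>[0, pi] \<times> [0, 2 * pi]\<close>.
\<close>

lemma spherical_coords_in_S2: "spherical_coords p \<in> S2"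
proof -
  obtain \<theta> \<phi> where p: "p = (\<theta>, \<phi>)"
    by (cases p)
  have "(sin \<theta> * cos \<phi>)\<^sup>2 + (sin \<theta> * sin \<phi>)\<^sup>2 + (cos \<theta>)\<^sup>2
      = (sin \<theta>)\<^sup>2 * ((sin \<phi>)\<^sup>2 + (cos \<phi>)\<^sup>2) + (cos \<theta>)\<^sup>2"
    by (simp only: power_mult_distrib distrib_left add_ac)
  then show ?thesis
    by (simp add: p spherical_coords_def norm_vec_def L2_set_def sum_3)
qed

lemma continuous_on_spherical_coords: "continuous_on UNIV spherical_coords"
proof -
  have "continuous_on UNIV (\<lambda>p. spherical_coords p $ 1)"
       "continuous_on UNIV (\<lambda>p. spherical_coords p $ 2)"
       "continuous_on UNIV (\<lambda>p. spherical_coords p $ 3)"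
    unfolding spherical_coords_def case_prod_unfold vector_3 by (intro continuous_intros)+
  then have "continuous_on UNIV (\<lambda>p. spherical_coords p $ i)" for i :: 3
    using exhaust_3[of i] by auto
  then have "continuous_on UNIV (\<lambda>p. \<chi> i. spherical_coords p $ i)"
    by (intro continuous_on_vec_lambda)
  then show ?thesis
    by simp
qed

lemma measurable_spherical_coords:
  "spherical_coords \<in> density (restrict_space lborel A) f \<rightarrow>\<^sub>M restrict_space borel S2"
proof -
  have "spherical_coords \<in> borel_measurable (restrict_space lborel A)"
    using borel_measurable_continuous_onI[OF continuous_on_spherical_coords]
    by (intro measurable_restrict_space1) simp
  then show ?thesis
    using spherical_coords_in_S2 by (intro measurable_restrict_space2) auto
qed

lemma nn_integral_sin: "(\<integral>\<^sup>+\<theta>. ennreal (sin \<theta>) * indicator {0..pi} \<theta> \<partial>lborel) = 2"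
proof -
  have "(\<integral>\<^sup>+\<theta>. ennreal (sin \<theta>) * indicator {0..pi} \<theta> \<partial>lborel) = ennreal (- cos pi - - cos 0)"
    by (rule nn_integral_FTC_Icc)
      (auto intro!: derivative_eq_intros sin_ge_zero)
  then show ?thesis
    by simp
qed

text \<open>
  The set \<open>S2\<close> is measurable before completion and its preimage under the coordinates is the whole
  rectangle, so the area is the integral of the density, which Tonelli's theorem factors as
  \<open>2 * (2 * pi)\<close>.
\<close>

lemma emeasure_sphere_area_S2: "emeasure sphere_area S2 = ennreal (4 * pi)"
proof -
  let ?R = "{0..pi} \<times> {0..2 * pi} :: (real \<times> real) set"
  let ?f = "\<lambda>(\<theta>, \<phi> :: real). ennreal (sin \<theta>)"
  let ?M = "density (restrict_space lborel ?R) ?f"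
  have R: "?R \<in> sets borel"
    by (intro borel_closed closed_Times closed_atLeastAtMost)
  have f: "?f \<in> borel_measurable borel"
    unfolding case_prod_unfold
    by (intro measurable_compose[OF _ measurable_ennreal] borel_measurable_continuous_onI
        continuous_intros)
  have "emeasure sphere_area S2 = emeasure (distr ?M (restrict_space borel S2) spherical_coords) S2"
    unfolding sphere_area_def by (simp add: sets_restrict_space_iff sets_completionI_sets)
  also have "\<dots> = emeasure ?M (spherical_coords -` S2 \<inter> space ?M)"
    by (intro emeasure_distr measurable_spherical_coords) (simp add: sets_restrict_space_iff)
  also have "spherical_coords -` S2 \<inter> space ?M = space (restrict_space lborel ?R)"
    using spherical_coords_in_S2 by auto
  also have "emeasure ?M \<dots> = (\<integral>\<^sup>+p. ?f p \<partial>restrict_space lborel ?R)"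
    using f by (subst emeasure_density)
      (auto intro!: measurable_restrict_space1 nn_integral_cong)
  also have "\<dots> = (\<integral>\<^sup>+p. ?f p * indicator ?R p \<partial>(lborel \<Otimes>\<^sub>M lborel))"
    using R by (subst nn_integral_restrict_space) (auto simp: lborel_prod)
  also have "\<dots> = (\<integral>\<^sup>+\<theta>. \<integral>\<^sup>+\<phi>. ?f (\<theta>, \<phi>) * indicator ?R (\<theta>, \<phi>) \<partial>lborel \<partial>lborel)"
    using R f by (intro lborel.nn_integral_fst[symmetric]) (simp add: lborel_prod)
  also have "\<dots> = (\<integral>\<^sup>+\<theta>. \<integral>\<^sup>+\<phi>. (ennreal (sin \<theta>) * indicator {0..pi} \<theta>) *
      indicator {0..2 * pi} \<phi> \<partial>lborel \<partial>lborel)"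
    by (simp add: indicator_times mult.assoc)
  also have "\<dots> = (\<integral>\<^sup>+\<theta>. (ennreal (sin \<theta>) * indicator {0..pi} \<theta>) * ennreal (2 * pi) \<partial>lborel)"
    by (simp add: nn_integral_cmult)
  also have "\<dots> = ennreal (4 * pi)"
    by (simp add: nn_integral_multc nn_integral_sin flip: ennreal_numeral ennreal_mult)
  finally show ?thesis .
qed

lemma integral_sphere_area_const: "(LINT y|sphere_area. c) = 4 * pi * (c :: real)"
proof -
  have "space sphere_area = S2"
    by (simp add: sphere_area_def space_restrict_space)
  then have "measure sphere_area (space sphere_area) = 4 * pi"
    by (simp add: measure_def emeasure_sphere_area_S2)
  then show ?thesis
    by simp
qed

lemma Ck_on_const: "Ck_on n U (\<lambda>_. c)"
  by (induction n arbitrary: c) auto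

lemma smooth_on_const: "smooth_on S (\<lambda>_. c)"
  unfolding smooth_on_def using Ck_on_const open_UNIV by blast

lemma sphere_laplacian_const: "sphere_laplacian (\<lambda>_. c) y = 0"
  by (simp add: sphere_laplacian_def laplacian_def)

theorem lemma1p3p4:
  fixes k :: nat
    and x :: "nat \<Rightarrow> real^3"
    and \<alpha> :: "nat \<Rightarrow> real"
    and \<mu> \<beta> :: real
  assumes "\<And>j. j \<in> {1..k} \<Longrightarrow> x j \<in> S2"
    and "inj_on x {1..k}"
    and "\<mu> > 0"
    and "\<beta> = - 1 - (\<Sum>j=1..k. \<alpha> j)"
    and "\<beta> > 0"
  shows "\<not> (\<exists>\<psi>. critical_point k x \<alpha> \<mu> \<psi>)"
proof
  assume "\<exists>\<psi>. critical_point k x \<alpha> \<mu> \<psi>"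
  then obtain \<psi> where "critical_point k x \<alpha> \<mu> \<psi>" ..
  then have "2 * (\<Sum>j=1..k. \<alpha> j * 1) + 1 / (2 * pi) * (LINT y|sphere_area. 1)
      - 1 / (2 * pi) * (LINT y|sphere_area. \<psi> y * sphere_laplacian (\<lambda>_. 1) y)
      - 2 * \<mu> * (LINT y|sphere_area. 1 * exp (2 * \<psi> y)) = 0"
    unfolding critical_point_def using smooth_on_const[of S2 1] by blast
  then have "2 * (\<Sum>j=1..k. \<alpha> j) + 2 = 2 * \<mu> * (LINT y|sphere_area. exp (2 * \<psi> y))"
    unfolding integral_sphere_area_const sphere_laplacian_const by simp
  moreover have "0 \<le> 2 * \<mu> * (LINT y|sphere_area. exp (2 * \<psi> y))"
    using \<open>\<mu> > 0\<close> by simp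
  ultimately show False
    using assms(4,5) by linarith
qed

end
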